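(* Let $k$ be an algebraically closed field and $\beta$ a basis set of $n$ monomials in the variables $x_1,\dots,x_r$, with associated monomial ideal $I_\beta\subseteq k[x_1,\dots,x_r]$. Then there exists a set $\mathcal S$ of minimal standard arrows for $\beta$ of cardinality $rn$ whose $k$-span in $M/M^2$ has dimension $rn$.
   Context: Monomials are identified with exponent vectors. A basis set is a finite nonempty set $\beta$ of monomials closed under taking divisors; $I_\beta$ is the ideal generated by monomials not in $\beta$ (colength $n=|\beta|$). $\mathbf H^n$ is the Hilbert scheme of $n$ points of $\mathbb A^r_k$, $t_\beta$ the point of $I_\beta$, $U_\beta\subseteq\mathbf H^n$ the open affine subscheme of points $t$ for which $\beta$ is a $k$-basis of $k[\mathbf x]/I_t$, with coordinate ring $R$. For $\mathbf x^{\mathbf d}\notin\beta$, $\mathbf x^{\mathbf j}\in\beta$, $c^{\mathbf d}_{\mathbf j}\in R$ is defined by $\mathbf x^{\mathbf d}-\sum_{\mathbf j\in\beta}c^{\mathbf d}_{\mathbf j}(t)\mathbf x^{\mathbf j}\in I_t$ for all $t\in U_\beta$; $M\subseteq R$ is the maximal ideal of $t_\beta$ (generated by all these functions), so $M/M^2$ is the cotangent space at $t_\beta$. An arrow is such a pair $(\mathbf d,\mathbf j)$, identified with $c^{\mathbf d}_{\mathbf j}$; its vector is $\mathbf j-\mathbf d$. An arrow is standard if its vector has exactly one negative component, and minimal if its tail $\mathbf x^{\mathbf d}$ is a minimal generator of $I_\beta$. *)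

theory Defs
  imports "HOL-Library.Poly_Mapping" "HOL-Library.Cardinality" "HOL-Computational_Algebra.Polynomial"
begin

(* Variables x_i are indexed by a finite type 'n, so r = CARD('n).
   Monomials = exponent vectors 'n \<Rightarrow>\<^sub>0 nat. *)
type_synonym 'n mon = "'n \<Rightarrow>\<^sub>0 nat"

(* An arrow (d, j) stands for the coordinate function c^d_j. *)
type_synonym 'n arrow = "'n mon \<times> 'n mon"

(* P = k[c^d_j]: polynomial ring over 'k in the arrow variables *)
type_synonym ('n, 'k) cpoly = "('n arrow \<Rightarrow>\<^sub>0 nat) \<Rightarrow>\<^sub>0 'k"

type_synonym ('n, 'k) xpoly = "'n mon \<Rightarrow>\<^sub>0 ('n, 'k) cpoly"

definition mon_dvd :: "'n mon \<Rightarrow> 'n mon \<Rightarrow> bool" where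
  "mon_dvd a b \<longleftrightarrow> (\<forall>i. Poly_Mapping.lookup a i \<le> Poly_Mapping.lookup b i)"

definition basis_set :: "'n mon set \<Rightarrow> bool" where
  "basis_set \<beta> \<longleftrightarrow> finite \<beta> \<and> \<beta> \<noteq> {} \<and> (\<forall>m\<in>\<beta>. \<forall>a. mon_dvd a m \<longrightarrow> a \<in> \<beta>)"

definition is_arrow :: "'n mon set \<Rightarrow> 'n arrow \<Rightarrow> bool" where
  "is_arrow \<beta> s \<longleftrightarrow> fst s \<notin> \<beta> \<and> snd s \<in> \<beta>"

definition standard_arrow :: "'n arrow \<Rightarrow> bool" where
  "standard_arrow s \<longleftrightarrow> card {i. Poly_Mapping.lookup (snd s) i < Poly_Mapping.lookup (fst s) i} = 1"

definition minimal_generator :: "'n mon set \<Rightarrow> 'n mon \<Rightarrow> bool" where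
  "minimal_generator \<beta> d \<longleftrightarrow> d \<notin> \<beta> \<and> (\<forall>a. mon_dvd a d \<and> a \<noteq> d \<longrightarrow> a \<in> \<beta>)"

definition minimal_standard_arrow :: "'n mon set \<Rightarrow> 'n arrow \<Rightarrow> bool" where
  "minimal_standard_arrow \<beta> s \<longleftrightarrow>
     is_arrow \<beta> s \<and> standard_arrow s \<and> minimal_generator \<beta> (fst s)"

definition ideal_gen :: "'a::comm_ring_1 set \<Rightarrow> 'a set" where
  "ideal_gen G = {x. \<exists>F r. finite F \<and> F \<subseteq> G \<and> x = (\<Sum>g\<in>F. r g * g)}"

definition cvar :: "'n arrow \<Rightarrow> ('n, 'k::comm_ring_1) cpoly" where
  "cvar s = Poly_Mapping.single (Poly_Mapping.single s 1) 1"

definition univ_gen :: "'n mon set \<Rightarrow> 'n mon \<Rightarrow> ('n, 'k::comm_ring_1) xpoly" where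
  "univ_gen \<beta> d = Poly_Mapping.single d 1 - (\<Sum>j\<in>\<beta>. Poly_Mapping.single j (cvar (d, j)))"

definition univ_ideal :: "'n mon set \<Rightarrow> ('n, 'k::comm_ring_1) xpoly set" where
  "univ_ideal \<beta> = ideal_gen {univ_gen \<beta> d | d. d \<notin> \<beta>}"

(* J \<subseteq> P: generated by the coefficients of elements of the universal ideal
   supported on beta.  R = P / J is the coordinate ring of U_beta. *)
definition hilb_ideal :: "'n mon set \<Rightarrow> ('n, 'k::comm_ring_1) cpoly set" where
  "hilb_ideal \<beta> = ideal_gen {Poly_Mapping.lookup f j | f j. f \<in> univ_ideal \<beta> \<and> Poly_Mapping.keys f \<subseteq> \<beta>}"

(* preimage in P of M^2 \<subseteq> R:  J + (c)^2 *)
definition M2_pre :: "'n mon set \<Rightarrow> ('n, 'k::comm_ring_1) cpoly set" where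
  "M2_pre \<beta> = ideal_gen (hilb_ideal \<beta> \<union>
       {cvar u * cvar v | u v. is_arrow \<beta> u \<and> is_arrow \<beta> v})"

definition cotangent_indep :: "'n mon set \<Rightarrow> 'n arrow set \<Rightarrow> 'k::field itself \<Rightarrow> bool" where
  "cotangent_indep \<beta> S _ \<longleftrightarrow>
     (\<forall>a :: 'n arrow \<Rightarrow> 'k.
        (\<Sum>s\<in>S. Poly_Mapping.single (Poly_Mapping.single s 1) (a s)) \<in> (M2_pre \<beta> :: ('n,'k) cpoly set)
        \<longrightarrow> (\<forall>s\<in>S. a s = 0))"

end

theory Submission
  imports Defs
begin

text \<open>
  A cotangent vector at the monomial ideal is a linear functional on the module homomorphisms
  \<open>\<tau>\<close> from the ideal to its quotient ring, and a homomorphism is determined by its values on minimal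
  generators. So it suffices to find enough homomorphisms with only standard matrix entries,
  and then to choose coordinates by Gaussian elimination.

  Fix a direction \<open>i\<close>. Deform the monomial ideal, in the variables other than \<open>i\<close> only, so that every
  column of \<open>\<beta>\<close> in direction \<open>i\<close> becomes a fat point over its own point of the hyperplane (this needs
  infinitely many scalars). For each \<open>b \<in> \<beta>\<close>, multiplication by the indicator function
  of the point under \<open>b\<close> and by the power \<open>-(b i + 1)\<close> of the variable \<open>i\<close> is a
  homomorphism on the deformed ideal. In Newton bases its entries are supported on standard arrows,
  and the leading form of a nonzero combination of these homomorphisms is a nonzero homomorphism
  on the original monomial ideal.
\<close>

section \<open>Tangent vectors and the cotangent space\<close>


lemma poly_mapping_single_induct [case_names zero single add]:
  fixes f :: "'a \<Rightarrow>\<^sub>0 'b::comm_monoid_add"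
  assumes "P 0" "\<And>k c. P (Poly_Mapping.single k c)" "\<And>f g. P f \<Longrightarrow> P g \<Longrightarrow> P (f + g)"
  shows "P f"
proof (induction f rule: update_induct)
  case const
  then show ?case using assms(1) by simp
next
  case (update f a b)
  have "Poly_Mapping.update a b f = f + Poly_Mapping.single a b"
    using update(1)
    by (intro poly_mapping_eqI)
      (auto simp: lookup_update lookup_add lookup_single when_def in_keys_iff)
  then show ?case using assms(2,3) update by simp
qed

definition coeff_sum :: "('a \<Rightarrow> 'b::zero \<Rightarrow> 'c::comm_monoid_add) \<Rightarrow> ('a \<Rightarrow>\<^sub>0 'b) \<Rightarrow> 'c" where
  "coeff_sum L f = (\<Sum>d\<in>Poly_Mapping.keys f. L d (Poly_Mapping.lookup f d))"

lemma coeff_sum_superset: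
  assumes "finite A" "Poly_Mapping.keys f \<subseteq> A" "\<And>d. L d 0 = 0"
  shows "coeff_sum L f = (\<Sum>d\<in>A. L d (Poly_Mapping.lookup f d))"
  unfolding coeff_sum_def using assms
  by (intro sum.mono_neutral_left) (auto simp: in_keys_iff)

lemma coeff_sum_zero [simp]: "coeff_sum L 0 = 0"
  by (simp add: coeff_sum_def)

lemma coeff_sum_single:
  assumes "L d 0 = 0"
  shows "coeff_sum L (Poly_Mapping.single d c) = L d c"
  using assms by (simp add: coeff_sum_def)

lemma coeff_sum_add:
  fixes f g :: "'a \<Rightarrow>\<^sub>0 'b::monoid_add"
  assumes "\<And>d. L d 0 = 0" "\<And>d a b. L d (a + b) = L d a + L d b"
  shows "coeff_sum L (f + g) = coeff_sum L f + coeff_sum L g"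
proof -
  let ?A = "Poly_Mapping.keys f \<union> Poly_Mapping.keys g"
  have "coeff_sum L h = (\<Sum>d\<in>?A. L d (Poly_Mapping.lookup h d))" 
    if "Poly_Mapping.keys h \<subseteq> ?A" for h
    using that by (intro coeff_sum_superset) (auto simp: assms)
  then show ?thesis
    using keys_add[of f g] by (simp add: lookup_add assms sum.distrib)
qed

text \<open>The derivation at the origin that sends the variable \<open>s\<close> to
  \<open>\<tau> s\<close>. The sum over \<open>keys t\<close> has at most one nonzero term and reads
  off the variable of a linear monomial without a choice operator.\<close>

definition linear_part :: "('v \<Rightarrow> 'k) \<Rightarrow> (('v \<Rightarrow>\<^sub>0 nat) \<Rightarrow>\<^sub>0 'k::comm_ring_1) \<Rightarrow> 'k" where
  "linear_part \<tau> = coeff_sum (\<lambda>t c. c * (\<Sum>s\<in>Poly_Mapping.keys t.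
     if t = Poly_Mapping.single s 1 then \<tau> s else 0))"

lemma linear_part_zero [simp]: "linear_part \<tau> 0 = 0"
  by (simp add: linear_part_def)

lemma linear_part_add: "linear_part \<tau> (p + q) = linear_part \<tau> p + linear_part \<tau> q"
  unfolding linear_part_def by (rule coeff_sum_add) (auto simp: algebra_simps)

lemma linear_part_sum: "linear_part \<tau> (\<Sum>x\<in>A. p x) = (\<Sum>x\<in>A. linear_part \<tau> (p x))"
  by (induction A rule: infinite_finite_induct) (auto simp: linear_part_add)

lemma linear_part_single:
  "linear_part \<tau> (Poly_Mapping.single t c) =
     c * (\<Sum>s\<in>Poly_Mapping.keys t. if t = Poly_Mapping.single s 1 then \<tau> s else 0)"
  unfolding linear_part_def by (rule coeff_sum_single) simp

lemma linear_part_single_single [simp]: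
  "linear_part \<tau> (Poly_Mapping.single (Poly_Mapping.single s (Suc 0)) a) = a * \<tau> s"
  by (simp add: linear_part_single)

lemma mon_add_eq_0_iff: "t + u = 0 \<longleftrightarrow> t = 0 \<and> u = 0" for t u :: "'v \<Rightarrow>\<^sub>0 nat"
  by (auto simp: poly_mapping_eq_iff fun_eq_iff lookup_add)

lemma mon_add_eq_single_1:
  fixes t u :: "'v \<Rightarrow>\<^sub>0 nat"
  assumes "t + u = Poly_Mapping.single s 1"
  shows "t = 0 \<or> u = 0"
proof -
  have *: "Poly_Mapping.lookup t x + Poly_Mapping.lookup u x = (if x = s then 1 else 0)" for x
    using arg_cong[OF assms, of "\<lambda>f. Poly_Mapping.lookup f x"]
    by (auto simp: lookup_add lookup_single when_def)
  have "t = 0" if "Poly_Mapping.lookup t s = 0"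
    using * that by (intro poly_mapping_eqI) (metis add_is_0 lookup_zero)
  moreover have "u = 0" if "Poly_Mapping.lookup u s = 0"
    using * that by (intro poly_mapping_eqI) (metis add_is_0 lookup_zero)
  ultimately show ?thesis using *[of s] by (auto simp: add_is_1)
qed

lemma lookup_mult_0:
  fixes p q :: "('v \<Rightarrow>\<^sub>0 nat) \<Rightarrow>\<^sub>0 'k::comm_ring_1"
  shows "Poly_Mapping.lookup (p * q) 0 = Poly_Mapping.lookup p 0 * Poly_Mapping.lookup q 0"
proof (induction p rule: poly_mapping_single_induct)
  case (single t a)
  show ?case
  proof (induction q rule: poly_mapping_single_induct)
    case (single u b)
    then show ?case
      by (auto simp: mult_single lookup_single when_def mon_add_eq_0_iff)
  qed (auto simp: algebra_simps lookup_add)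
qed (auto simp: algebra_simps lookup_add)

text \<open>Leibniz rule at the origin: a product of two nonconstant monomials is never a single
  variable, so one factor must contribute its constant term.\<close>

lemma linear_part_mult:
  "linear_part \<tau> (p * q) =
     Poly_Mapping.lookup p 0 * linear_part \<tau> q + Poly_Mapping.lookup q 0 * linear_part \<tau> p"
proof (induction p rule: poly_mapping_single_induct)
  case (single t a)
  show ?case
  proof (induction q rule: poly_mapping_single_induct)
    case (single u b)
    consider "t = 0" | "u = 0" | "t \<noteq> 0" "u \<noteq> 0" by blast
    then show ?case
    proof cases
      case 3
      then have "t + u \<noteq> Poly_Mapping.single s 1" for s
        using mon_add_eq_single_1[of t u s] by auto
      then show ?thesis using 3
        by (simp add: mult_single linear_part_single lookup_single when_def)
    qed (auto simp: mult_single linear_part_single lookup_single when_def)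
  qed (auto simp: algebra_simps lookup_add linear_part_add)
qed (auto simp: algebra_simps lookup_add linear_part_add)

section \<open>First-order deformations of the monomial ideal\<close>

lemma ideal_gen_subset:
  fixes G W :: "'a::comm_ring_1 set"
  assumes "G \<subseteq> W" "0 \<in> W" "\<And>x y. x \<in> W \<Longrightarrow> y \<in> W \<Longrightarrow> x + y \<in> W" "\<And>r x. x \<in> W \<Longrightarrow> r * x \<in> W"
  shows "ideal_gen G \<subseteq> W"
proof
  fix x assume "x \<in> ideal_gen G"
  then obtain F r where "finite F" "F \<subseteq> G" "x = (\<Sum>g\<in>F. r g * g)"
    unfolding ideal_gen_def by blast
  moreover have "(\<Sum>g\<in>F. r g * g) \<in> W"
    using \<open>finite F\<close> \<open>F \<subseteq> G\<close> by (induction F rule: finite_induct) (use assms in auto)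
  ultimately show "x \<in> W" by simp
qed

text \<open>Tangent vectors at the monomial ideal: \<open>\<tau> (d, j)\<close> is the coefficient of \<open>x\<^sup>j\<close> in the image
  of \<open>x\<^sup>d\<close> under a module homomorphism from the ideal to its quotient ring.\<close>

definition tangent :: "'n mon set \<Rightarrow> ('n arrow \<Rightarrow> 'k::zero) \<Rightarrow> bool" where
  "tangent \<beta> \<tau> \<longleftrightarrow> (\<forall>d e j. d \<notin> \<beta> \<longrightarrow> j \<in> \<beta> \<longrightarrow>
     \<tau> (d + e, j) = (if mon_dvd e j then \<tau> (d, j - e) else 0))"

lemma mon_dvd_iff: "mon_dvd a b \<longleftrightarrow> (\<exists>c. b = a + c)"
proof
  assume "mon_dvd a b"
  then have "b = a + (b - a)"
    by (intro poly_mapping_eqI) (auto simp: lookup_add lookup_minus mon_dvd_def)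
  then show "\<exists>c. b = a + c" by blast
qed (auto simp: mon_dvd_def lookup_add)

lemma basis_set_downD: "basis_set \<beta> \<Longrightarrow> a + c \<in> \<beta> \<Longrightarrow> a \<in> \<beta>"
  unfolding basis_set_def mon_dvd_iff by blast

lemma basis_set_finite: "basis_set \<beta> \<Longrightarrow> finite \<beta>"
  unfolding basis_set_def by blast

text \<open>Sending each variable \<open>s\<close> to \<open>\<epsilon> * \<tau> s\<close> with \<open>\<epsilon>\<^sup>2 = 0\<close>, this is the \<open>\<epsilon>\<close>-coefficient of \<open>x\<^sup>j\<close> in
  the remainder of \<open>f\<close> modulo the universal ideal.\<close>

definition first_order :: "'n mon set \<Rightarrow> ('n arrow \<Rightarrow> 'k) \<Rightarrow> 'n mon \<Rightarrow> ('n, 'k::comm_ring_1) xpoly \<Rightarrow> 'k" where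
  "first_order \<beta> \<tau> j = coeff_sum (\<lambda>d c. (if d = j then linear_part \<tau> c else 0)
      + (if d \<in> \<beta> then 0 else Poly_Mapping.lookup c 0 * \<tau> (d, j)))"

lemma first_order_zero [simp]: "first_order \<beta> \<tau> j 0 = 0"
  by (simp add: first_order_def)

lemma first_order_add: "first_order \<beta> \<tau> j (f + g) = first_order \<beta> \<tau> j f + first_order \<beta> \<tau> j g"
  unfolding first_order_def by (rule coeff_sum_add) (auto simp: algebra_simps linear_part_add lookup_add)

lemma first_order_diff: "first_order \<beta> \<tau> j (f - g) = first_order \<beta> \<tau> j f - first_order \<beta> \<tau> j g"
  using first_order_add[of \<beta> \<tau> j "f - g" g] by (simp add: algebra_simps)

lemma first_order_sum: "first_order \<beta> \<tau> j (\<Sum>x\<in>A. f x) = (\<Sum>x\<in>A. first_order \<beta> \<tau> j (f x))"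
  by (induction A rule: infinite_finite_induct) (auto simp: first_order_add)

lemma first_order_single:
  "first_order \<beta> \<tau> j (Poly_Mapping.single d c) = (if d = j then linear_part \<tau> c else 0)
      + (if d \<in> \<beta> then 0 else Poly_Mapping.lookup c 0 * \<tau> (d, j))"
  unfolding first_order_def by (rule coeff_sum_single) simp

lemma lookup_cvar_0 [simp]: "Poly_Mapping.lookup (cvar s) 0 = 0"
proof -
  have "Poly_Mapping.single s (1::nat) \<noteq> 0" by (metis lookup_single_eq lookup_zero zero_neq_one)
  then show ?thesis by (simp add: cvar_def lookup_single when_def)
qed

lemma linear_part_cvar [simp]: "linear_part \<tau> (cvar s) = \<tau> s"
  by (simp add: cvar_def)

lemma single_mult_univ_gen:
  "Poly_Mapping.single e c * univ_gen \<beta> d = Poly_Mapping.single (d + e) c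
     - (\<Sum>j\<in>\<beta>. Poly_Mapping.single (j + e) (c * cvar (d, j)))"
  by (simp add: univ_gen_def right_diff_distrib sum_distrib_left mult_single add.commute[of e])

text \<open>For a monomial multiplier \<open>e\<close>, the contribution of \<open>d + e\<close>
  cancels against the shifted terms of \<open>univ_gen\<close> by the tangent relation; general
  multipliers follow by additivity.\<close>

lemma first_order_univ_gen:
  assumes \<beta>: "basis_set \<beta>" and \<tau>: "tangent \<beta> \<tau>" and d: "d \<notin> \<beta>" and j: "j \<in> \<beta>"
  shows "first_order \<beta> \<tau> j (r * univ_gen \<beta> d) = 0"
proof (induction r rule: poly_mapping_single_induct)
  case (single e c)
  have de: "d + e \<notin> \<beta>" using basis_set_downD[OF \<beta>] d by blast
  \<comment> \<open>\<open>c * cvar (d, i)\<close> has no constant term, so only its linear part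
    enters, and only at exponent \<open>j\<close>.\<close>
  have "(\<Sum>i\<in>\<beta>. first_order \<beta> \<tau> j (Poly_Mapping.single (i + e) (c * cvar (d, i)))) =
    (\<Sum>i\<in>\<beta>. if i + e = j then Poly_Mapping.lookup c 0 * \<tau> (d, i) else 0)"
    by (intro sum.cong refl) (simp add: first_order_single linear_part_mult lookup_mult_0)
  also have "\<dots> = Poly_Mapping.lookup c 0 * (if mon_dvd e j then \<tau> (d, j - e) else 0)"
  proof (cases "mon_dvd e j")
    case True
    then obtain i0 where i0: "j = e + i0" by (auto simp: mon_dvd_iff)
    then have "i0 \<in> \<beta>" using basis_set_downD[OF \<beta>, of i0 e] j by (simp add: add.commute)
    moreover have "i + e = j \<longleftrightarrow> i0 = i" for i
      using i0 by (auto simp: add.commute)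
    ultimately show ?thesis using True i0 basis_set_finite[OF \<beta>] by simp
  next
    case False
    then have "i + e \<noteq> j" for i by (auto simp: mon_dvd_iff add.commute)
    then show ?thesis using False by simp
  qed
  also have "\<dots> = Poly_Mapping.lookup c 0 * \<tau> (d + e, j)"
    using \<tau> d j by (simp add: tangent_def)
  finally show ?case
    using de j by (auto simp: single_mult_univ_gen first_order_diff first_order_sum first_order_single)
qed (auto simp: first_order_add algebra_simps)

text \<open>At the origin the universal ideal becomes the monomial ideal, whose elements have no
  terms in \<beta>.\<close>

lemma const_univ_gen:
  fixes r :: "('n, 'k::comm_ring_1) xpoly"
  assumes \<beta>: "basis_set \<beta>" and d: "d \<notin> \<beta>" and j: "j \<in> \<beta>"
  shows "Poly_Mapping.lookup (Poly_Mapping.lookup (r * univ_gen \<beta> d) j) 0 = 0"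
proof (induction r rule: poly_mapping_single_induct)
  case (single e c)
  have de: "d + e \<noteq> j" using basis_set_downD[OF \<beta>] d j by blast
  have "Poly_Mapping.lookup (Poly_Mapping.lookup (Poly_Mapping.single (i + e) (c * cvar (d, i))) j) 0 = 0" for i
    by (auto simp: lookup_single when_def lookup_mult_0)
  then show ?case using de
    by (simp add: single_mult_univ_gen lookup_minus lookup_sum lookup_single)
qed (auto simp: lookup_add algebra_simps)

lemma univ_ideal_first_order:
  assumes \<beta>: "basis_set \<beta>" and \<tau>: "tangent \<beta> \<tau>" and j: "j \<in> \<beta>" and f: "f \<in> univ_ideal \<beta>"
  shows "first_order \<beta> \<tau> j f = 0" "Poly_Mapping.lookup (Poly_Mapping.lookup f j) 0 = 0"
proof -
  obtain F r where F: "F \<subseteq> {univ_gen \<beta> d |d. d \<notin> \<beta>}" "f = (\<Sum>g\<in>F. r g * g)"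
    using f unfolding univ_ideal_def ideal_gen_def by blast
  have "first_order \<beta> \<tau> j (r g * g) = 0 \<and> Poly_Mapping.lookup (Poly_Mapping.lookup (r g * g) j) 0 = 0"
    if "g \<in> F" for g
    using F(1) that first_order_univ_gen[OF \<beta> \<tau> _ j] const_univ_gen[OF \<beta> _ j] by blast
  then show "first_order \<beta> \<tau> j f = 0" "Poly_Mapping.lookup (Poly_Mapping.lookup f j) 0 = 0"
    unfolding F(2) by (simp_all add: first_order_sum lookup_sum)
qed

text \<open>A polynomial supported on \<beta> is its own remainder, so generators of
  \<open>hilb_ideal\<close> can be tested by \<open>linear_part\<close>.\<close>

lemma first_order_supported:
  assumes "Poly_Mapping.keys f \<subseteq> \<beta>"
  shows "first_order \<beta> \<tau> j f = linear_part \<tau> (Poly_Mapping.lookup f j)"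
proof -
  have "first_order \<beta> \<tau> j f =
     (\<Sum>d\<in>Poly_Mapping.keys f. if d = j then linear_part \<tau> (Poly_Mapping.lookup f d) else 0)"
    unfolding first_order_def coeff_sum_def using assms by (intro sum.cong) auto
  then show ?thesis by (auto simp: in_keys_iff)
qed

lemma linear_part_M2_pre:
  fixes p :: "('n, 'k::comm_ring_1) cpoly"
  assumes \<beta>: "basis_set \<beta>" and \<tau>: "tangent \<beta> \<tau>" and p: "p \<in> M2_pre \<beta>"
  shows "linear_part \<tau> p = 0"
proof -
  \<comment> \<open>The condition on constant terms is what makes this set an ideal, by the Leibniz
    rule.\<close>
  let ?W = "{p :: ('n, 'k) cpoly. Poly_Mapping.lookup p 0 = 0 \<and> linear_part \<tau> p = 0}"
  have ideal: "ideal_gen G \<subseteq> ?W" if "G \<subseteq> ?W" for G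
    using that by (rule ideal_gen_subset) (simp_all add: lookup_add linear_part_add lookup_mult_0 linear_part_mult)
  have "hilb_ideal \<beta> \<subseteq> ?W"
    unfolding hilb_ideal_def
  proof (rule ideal, clarify)
    fix f :: "('n, 'k) xpoly" and j assume f: "f \<in> univ_ideal \<beta>" "Poly_Mapping.keys f \<subseteq> \<beta>"
    show "Poly_Mapping.lookup (Poly_Mapping.lookup f j) 0 = 0 \<and> linear_part \<tau> (Poly_Mapping.lookup f j) = 0"
    proof (cases "j \<in> \<beta>")
      case True
      then show ?thesis
        using univ_ideal_first_order[OF \<beta> \<tau> True f(1)] first_order_supported[OF f(2)] by simp
    next
      case False
      then have "Poly_Mapping.lookup f j = 0" using f(2) by (auto simp: in_keys_iff)
      then show ?thesis by simp
    qed
  qed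
  then have "M2_pre \<beta> \<subseteq> ?W"
    unfolding M2_pre_def by (intro ideal) (auto simp: lookup_mult_0 linear_part_mult)
  then show ?thesis using p by blast
qed

text \<open>Tangent vectors are functionals on the cotangent space, so a relation there can be
  evaluated on each of them.\<close>

lemma cotangent_indepI:
  assumes "basis_set \<beta>"
    and "\<And>a. (\<And>\<tau>. tangent \<beta> \<tau> \<Longrightarrow> (\<Sum>s\<in>S. a s * \<tau> s) = 0) \<Longrightarrow> \<forall>s\<in>S. a s = (0::'k::field)"
  shows "cotangent_indep \<beta> S TYPE('k)"
  unfolding cotangent_indep_def
proof (intro allI impI)
  fix a :: "'a arrow \<Rightarrow> 'k"
  assume *: "(\<Sum>s\<in>S. Poly_Mapping.single (Poly_Mapping.single s 1) (a s)) \<in> M2_pre \<beta>"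
  show "\<forall>s\<in>S. a s = 0"
  proof (rule assms(2))
    fix \<tau> :: "'a arrow \<Rightarrow> 'k" assume "tangent \<beta> \<tau>"
    from linear_part_M2_pre[OF assms(1) this *] show "(\<Sum>s\<in>S. a s * \<tau> s) = 0"
      by (simp add: linear_part_sum)
  qed
qed

section \<open>Independent coordinates\<close>

text \<open>Gaussian elimination. The combinations of \<open>F\<close> need not lie in
  \<open>T\<close>, which only supplies truncations of them, since taking leading forms is not
  linear. Each step picks a pivot from a truncation of \<open>F k0\<close> and clears that
  coordinate from the others.\<close>

lemma exists_independent_coordinates:
  fixes F :: "'i \<Rightarrow> 'x \<Rightarrow> 'k::field"
  assumes "finite K"
    and "\<And>c :: 'i \<Rightarrow> 'k. \<exists>k\<in>K. c k \<noteq> 0 \<Longrightarrow> \<exists>\<tau>\<in>T. \<exists>s\<in>X. \<tau> s \<noteq> 0 \<and> (\<forall>x\<in>X. \<tau> x \<noteq> 0 \<longrightarrow> \<tau> x = (\<Sum>k\<in>K. c k * F k x))"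
  shows "\<exists>S\<subseteq>X. finite S \<and> card S = card K \<and>
           (\<forall>a. (\<forall>\<tau>\<in>T. (\<Sum>s\<in>S. a s * \<tau> s) = 0) \<longrightarrow> (\<forall>s\<in>S. a s = 0))"
  using assms
proof (induction K arbitrary: F T rule: finite_induct)
  case empty
  then show ?case by (intro exI[of _ "{}"]) auto
next
  case (insert k0 K)
  have [simp]: "(\<Sum>k\<in>K. (if k = k0 then 1 else 0) * F k x) = 0" for x
    using insert.hyps by (intro sum.neutral) auto
  obtain \<tau>0 s0 where \<tau>0: "\<tau>0 \<in> T" "s0 \<in> X" "\<tau>0 s0 \<noteq> 0" "\<tau>0 s0 = F k0 s0"
    using insert.prems[of "\<lambda>k. if k = k0 then 1 else 0"] insert.hyps by auto
  define F' where "F' = (\<lambda>k x. F k x - F k s0 / F k0 s0 * F k0 x)"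
  \<comment> \<open>Vectors of \<open>T'\<close> do not see the pivot, so they control the
    coefficients on \<open>S\<close>; \<open>\<tau>0\<close> then settles the coefficient at
    \<open>s0\<close>.\<close>
  define T' where "T' = {\<tau>\<in>T. \<tau> s0 = 0}"
  have "\<exists>S\<subseteq>X. finite S \<and> card S = card K \<and>
           (\<forall>a. (\<forall>\<tau>\<in>T'. (\<Sum>s\<in>S. a s * \<tau> s) = 0) \<longrightarrow> (\<forall>s\<in>S. a s = 0))"
  proof (rule insert.IH[of T' F'])
    fix c :: "'i \<Rightarrow> 'k" assume c: "\<exists>k\<in>K. c k \<noteq> 0"
    \<comment> \<open>The coefficient at \<open>k0\<close> is chosen so that \<open>c'\<close> on
      \<open>F\<close> gives the same combination as \<open>c\<close> on \<open>F'\<close>.\<close>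
    define c' where "c' = (\<lambda>k. if k = k0 then - (\<Sum>k\<in>K. c k * F k s0) / F k0 s0 else c k)"
    have eq: "(\<Sum>k\<in>insert k0 K. c' k * F k x) = (\<Sum>k\<in>K. c k * F' k x)" for x
    proof -
      have "(\<Sum>k\<in>K. c' k * F k x) = (\<Sum>k\<in>K. c k * F k x)"
        using insert.hyps by (intro sum.cong) (auto simp: c'_def)
      moreover have "(\<Sum>k\<in>K. c k * F' k x) = 
         (\<Sum>k\<in>K. c k * F k x) - (\<Sum>k\<in>K. c k * F k s0) / F k0 s0 * F k0 x"
        unfolding F'_def sum_divide_distrib sum_distrib_right sum_subtractf[symmetric]
        by (intro sum.cong refl) (simp add: field_simps)
      ultimately show ?thesis using insert.hyps by (simp add: c'_def)
    qed
    have "\<exists>k\<in>insert k0 K. c' k \<noteq> 0" using c insert.hyps unfolding c'_def by auto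
    then obtain \<tau> s where *: "\<tau> \<in> T" "s \<in> X" "\<tau> s \<noteq> 0"
        "\<And>x. x \<in> X \<Longrightarrow> \<tau> x \<noteq> 0 \<Longrightarrow> \<tau> x = (\<Sum>k\<in>K. c k * F' k x)"
      using insert.prems[of c'] unfolding eq by blast
    \<comment> \<open>A nonzero entry of \<open>\<tau>\<close> at \<open>s0\<close> would equal a
      combination of zeros.\<close>
    have "F' k s0 = 0" for k unfolding F'_def using \<tau>0 by simp
    then have "\<tau> s0 = 0" using *(4)[OF \<open>s0 \<in> X\<close>] by auto
    then show "\<exists>\<tau>\<in>T'. \<exists>s\<in>X. \<tau> s \<noteq> 0 \<and> (\<forall>x\<in>X. \<tau> x \<noteq> 0 \<longrightarrow> \<tau> x = (\<Sum>k\<in>K. c k * F' k x))"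
      using *(1-3) by (intro bexI[of _ \<tau>] bexI[of _ s] conjI ballI impI *(4)) (simp_all add: T'_def)
  qed
  then obtain S where S: "S \<subseteq> X" "finite S" "card S = card K"
    and *: "\<forall>a. (\<forall>\<tau>\<in>T'. (\<Sum>s\<in>S. a s * \<tau> s) = 0) \<longrightarrow> (\<forall>s\<in>S. a s = 0)"
    by blast
  have S_indep: "\<forall>s\<in>S. a s = 0" if "\<And>\<tau>. \<tau> \<in> T' \<Longrightarrow> (\<Sum>s\<in>S. a s * \<tau> s) = 0" for a
    using *[THEN spec, of a] that by blast
  \<comment> \<open>Otherwise the unit coefficient vector at \<open>s0\<close> would be a nontrivial
    relation annihilated by all of \<open>T'\<close>.\<close>
  have s0: "s0 \<notin> S"
  proof
    assume "s0 \<in> S"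
    have "(\<Sum>s\<in>S. (if s = s0 then 1 else 0) * \<tau> s) = 0" if "\<tau> \<in> T'" for \<tau>
      using that by (intro sum.neutral) (auto simp: T'_def)
    from S_indep[OF this] \<open>s0 \<in> S\<close> show False by auto
  qed
  show ?case
  proof (intro exI[of _ "insert s0 S"] conjI allI impI)
    fix a assume a: "\<forall>\<tau>\<in>T. (\<Sum>s\<in>insert s0 S. a s * \<tau> s) = 0"
    have "\<forall>s\<in>S. a s = 0"
      using a s0 S(2) by (intro S_indep) (auto simp: T'_def)
    moreover from this have "a s0 = 0"
      using a \<tau>0 s0 S(2) by auto
    ultimately show "\<forall>s\<in>insert s0 S. a s = 0" by blast
  qed (use S s0 \<tau>0 insert.hyps in auto)
qed

text \<open>Over a finite field, one plus the product of all \<open>x - a\<close> has positive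
  degree but takes the value 1 everywhere.\<close>

lemma infinite_UNIV_alg_closed_field: "infinite (UNIV :: 'k::alg_closed_field set)"
proof
  assume fin: "finite (UNIV :: 'k set)"
  define q where "q = (\<Prod>a\<in>(UNIV :: 'k set). [:- a, 1:])"
  have "degree q = card (UNIV :: 'k set)"
    unfolding q_def by (subst degree_prod_eq_sum_degree) auto
  then have "degree (1 + q) > 0"
    using fin by (simp add: degree_add_eq_right finite_UNIV_card_ge_0)
  then obtain x where x: "poly (1 + q) x = 0"
    using alg_closed_imp_poly_has_root by blast
  have "poly q x = 0"
    unfolding q_def poly_prod using fin by (intro prod_zero bexI[of _ x]) auto
  then show False using x by simp
qed

section \<open>Deformed tangent vectors and their leading forms\<close>

text \<open>The weight of \<open>f (y b)\<close> in the divided difference of \<open>f\<close> at the nodes \<open>y d, \<dots>, y j\<close>.\<close>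

definition dd_weight :: "(nat \<Rightarrow> 'k::field) \<Rightarrow> nat \<Rightarrow> nat \<Rightarrow> nat \<Rightarrow> 'k" where
  "dd_weight y d b j = (if d \<le> b \<and> b \<le> j then inverse (\<Prod>e\<in>{d..j}-{b}. y b - y e) else 0)"

lemma dd_weight_nonzeroD: "dd_weight y d b j \<noteq> 0 \<Longrightarrow> d \<le> b \<and> b \<le> j"
  by (auto simp: dd_weight_def split: if_splits)

lemma dd_weight_same: "dd_weight y b c b = (if c = b then 1 else 0)"
  by (auto simp: dd_weight_def)

text \<open>Dropping the node \<open>y d\<close> removes one factor of the denominator; at
  \<open>b = d\<close> both sides vanish.\<close>

lemma dd_weight_Suc_left:
  assumes "inj y"
  shows "dd_weight y (Suc d) b j = (y b - y d) * dd_weight y d b j"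
proof (cases "Suc d \<le> b \<and> b \<le> j")
  case True
  then have "{d..j} - {b} = insert d ({Suc d..j} - {b})" by auto
  moreover have "y b \<noteq> y d" using assms True by (auto dest: injD)
  ultimately show ?thesis using True by (simp add: dd_weight_def)
next
  case False
  then show ?thesis by (cases "b = d") (auto simp: dd_weight_def)
qed

lemma dd_weight_Suc_right:
  assumes "inj y"
  shows "dd_weight y d b j = (y b - y (Suc j)) * dd_weight y d b (Suc j)"
proof (cases "d \<le> b \<and> b \<le> j")
  case True
  then have "{d..Suc j} - {b} = insert (Suc j) ({d..j} - {b})" by auto
  moreover have "y b \<noteq> y (Suc j)" using assms True by (auto dest: injD)
  ultimately show ?thesis using True by (simp add: dd_weight_def)
next
  case False
  then show ?thesis by (cases "b = Suc j") (auto simp: dd_weight_def)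
qed

text \<open>The recursion of divided differences, read at the weight of
  \<open>f (y b)\<close>.\<close>

lemma dd_weight_shift:
  assumes "inj y"
  shows "dd_weight y (Suc d) b (Suc j) - dd_weight y d b j = (y (Suc j) - y d) * dd_weight y d b (Suc j)"
  unfolding dd_weight_Suc_left[OF assms] dd_weight_Suc_right[OF assms, of d b j]
  by (simp add: algebra_simps)

section \<open>Tangent vectors on single variables and on minimal generators\<close>

lemma mon_unit_induct [case_names zero step]:
  fixes e :: "'n::finite mon"
  assumes "P 0" "\<And>e l. P e \<Longrightarrow> P (e + Poly_Mapping.single l 1)"
  shows "P e"
proof (induction "\<Sum>l\<in>UNIV. Poly_Mapping.lookup e l" arbitrary: e)
  case 0
  then have "e = 0" by (intro poly_mapping_eqI) simp
  then show ?case using assms(1) by simp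
next
  case (Suc n)
  then obtain l where l: "Poly_Mapping.lookup e l \<noteq> 0"
    by (metis (mono_tags, lifting) nat.distinct(1) sum.neutral)
  define e' where "e' = e - Poly_Mapping.single l 1"
  have e: "e = e' + Poly_Mapping.single l 1"
    using l by (intro poly_mapping_eqI) (auto simp: e'_def lookup_add lookup_minus lookup_single when_def)
  have "n = (\<Sum>l\<in>UNIV. Poly_Mapping.lookup e' l)"
    using Suc(2) unfolding e by (simp add: lookup_add sum.distrib lookup_single when_def)
  then have "P e'" by (rule Suc(1))
  then show ?case unfolding e by (rule assms(2))
qed

lemma tangentI:
  fixes \<tau> :: "'n::finite arrow \<Rightarrow> 'k::zero"
  assumes \<beta>: "basis_set \<beta>"
    and unit: "\<And>d j l. d \<notin> \<beta> \<Longrightarrow> j \<in> \<beta> \<Longrightarrow> \<tau> (d + Poly_Mapping.single l 1, j) =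
          (if Poly_Mapping.lookup j l = 0 then 0 else \<tau> (d, j - Poly_Mapping.single l 1))"
  shows "tangent \<beta> \<tau>"
  unfolding tangent_def
proof (intro allI impI)
  fix d e j assume d: "d \<notin> \<beta>" and "j \<in> \<beta>"
  from \<open>j \<in> \<beta>\<close> show "\<tau> (d + e, j) = (if mon_dvd e j then \<tau> (d, j - e) else 0)"
  proof (induction e arbitrary: j rule: mon_unit_induct)
    case zero
    then show ?case by (simp add: mon_dvd_def)
  next
    case (step e l)
    let ?u = "Poly_Mapping.single l (1::nat)"
    have de: "d + e \<notin> \<beta>" using basis_set_downD[OF \<beta>] d by blast
    have unit': "\<tau> (d + (e + ?u), j) = (if Poly_Mapping.lookup j l = 0 then 0 else \<tau> (d + e, j - ?u))"
      using unit[OF de step.prems] by (simp add: add.assoc)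
    show ?case
    proof (cases "Poly_Mapping.lookup j l = 0")
      case True
      then have "\<not> mon_dvd (e + ?u) j" by (auto simp: mon_dvd_def lookup_add intro!: exI[of _ l])
      then show ?thesis using True unit' by simp
    next
      case False
      have j: "j = (j - ?u) + ?u" using False
        by (intro poly_mapping_eqI) (auto simp: lookup_add lookup_minus lookup_single when_def)
      then have "j - ?u \<in> \<beta>" using basis_set_downD[OF \<beta>] step.prems by metis
      moreover have "mon_dvd (e + ?u) j \<longleftrightarrow> mon_dvd e (j - ?u)"
        by (subst j) (simp add: mon_dvd_def lookup_add)
      moreover have "j - (e + ?u) = j - ?u - e"
        by (intro poly_mapping_eqI) (simp add: lookup_add lookup_minus)
      ultimately show ?thesis using False unit' step.IH by simp
    qed
  qed
qed

text \<open>A tail that is not a minimal generator is \<open>a + c\<close> with \<open>a\<close>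
  outside \<beta>, and a nonzero arrow moves back along \<open>c\<close> without changing its entry;
  the degree of the tail drops.\<close>

lemma tangent_nonzero_minimal:
  fixes \<tau> :: "'n::finite arrow \<Rightarrow> 'k::zero"
  assumes \<beta>: "basis_set \<beta>" and \<tau>: "tangent \<beta> \<tau>"
    and "d \<notin> \<beta>" "j \<in> \<beta>" "\<tau> (d, j) \<noteq> 0"
  shows "\<exists>d' j'. minimal_generator \<beta> d' \<and> j' \<in> \<beta> \<and> \<tau> (d', j') \<noteq> 0"
  using assms(3-)
proof (induction "\<Sum>l\<in>UNIV. Poly_Mapping.lookup d l" arbitrary: d j rule: less_induct)
  case less
  show ?case
  proof (cases "minimal_generator \<beta> d")
    case True
    then show ?thesis using less.prems by blast
  next
    case False
    then obtain a c where ac: "d = a + c" "c \<noteq> 0" "a \<notin> \<beta>"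
      using \<open>d \<notin> \<beta>\<close> unfolding minimal_generator_def mon_dvd_iff by auto
    then have c: "mon_dvd c j" "\<tau> (a, j - c) \<noteq> 0"
      using \<tau> less.prems unfolding tangent_def by (auto split: if_splits)
    have "j - c \<in> \<beta>"
    proof -
      obtain b where "j = c + b" using c(1) mon_dvd_iff by blast
      then show ?thesis using basis_set_downD[OF \<beta>, of b c] less.prems by (simp add: add.commute)
    qed
    moreover have "(\<Sum>l\<in>UNIV. Poly_Mapping.lookup a l) < (\<Sum>l\<in>UNIV. Poly_Mapping.lookup d l)"
    proof -
      obtain l where "Poly_Mapping.lookup c l \<noteq> 0"
        using ac(2) by (metis lookup_zero poly_mapping_eqI)
      then show ?thesis unfolding ac
        by (auto simp: lookup_add sum.distrib intro!: sum_pos2[of _ l])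
    qed
    ultimately show ?thesis using less.hyps[of a "j - c"] c(2) ac(3) by blast
  qed
qed

section \<open>Homomorphisms on the deformed ideal\<close>

text \<open>The entry at \<open>(d, j)\<close> of multiplication by the indicator function of the point \<open>b\<close> and by the
  power \<open>-(b i + 1)\<close> of the variable \<open>i\<close>, in the Newton basis \<open>\<Prod>l. \<Prod>e<d l. (x l - y e)\<close>,
  where \<open>l \<noteq> i\<close>. The values of the basis element \<open>d\<close> at \<open>b\<close> cancel the nodes below \<open>d l\<close>.\<close>

definition deformed :: "(nat \<Rightarrow> 'k::field) \<Rightarrow> 'n::finite \<Rightarrow> 'n mon \<Rightarrow> 'n arrow \<Rightarrow> 'k" where
  "deformed y i b = (\<lambda>(d, j).
     if Poly_Mapping.lookup d i = Suc (Poly_Mapping.lookup j i + Poly_Mapping.lookup b i)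
     then \<Prod>l\<in>-{i}. dd_weight y (Poly_Mapping.lookup d l) (Poly_Mapping.lookup b l) (Poly_Mapping.lookup j l)
     else 0)"

text \<open>The grading by which leading forms are taken.\<close>

definition transverse_degree :: "'n::finite \<Rightarrow> 'n arrow \<Rightarrow> int" where
  "transverse_degree i = (\<lambda>(d, j). \<Sum>l\<in>-{i}. int (Poly_Mapping.lookup j l) - int (Poly_Mapping.lookup d l))"

lemma deformed_nonzeroD:
  assumes "deformed y i b (d, j) \<noteq> 0"
  shows "Poly_Mapping.lookup d i = Suc (Poly_Mapping.lookup j i + Poly_Mapping.lookup b i)"
    and "l \<noteq> i \<Longrightarrow> Poly_Mapping.lookup d l \<le> Poly_Mapping.lookup b l \<and> Poly_Mapping.lookup b l \<le> Poly_Mapping.lookup j l"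
  using assms by (auto simp: deformed_def dest!: dd_weight_nonzeroD split: if_splits)

text \<open>Direction \<open>i\<close> is not deformed, so the tangent relation holds here without
  an error term.\<close>

lemma deformed_shift_axis:
  assumes "Poly_Mapping.lookup j i \<noteq> 0"
  shows "deformed y i b (d + Poly_Mapping.single i 1, j) = deformed y i b (d, j - Poly_Mapping.single i 1)"
proof -
  have "(\<Prod>l\<in>-{i}. dd_weight y (Poly_Mapping.lookup (d + Poly_Mapping.single i 1) l) (Poly_Mapping.lookup b l) (Poly_Mapping.lookup j l))
    = (\<Prod>l\<in>-{i}. dd_weight y (Poly_Mapping.lookup d l) (Poly_Mapping.lookup b l) (Poly_Mapping.lookup (j - Poly_Mapping.single i 1) l))"
    by (intro prod.cong) (auto simp: lookup_add lookup_minus lookup_single when_def)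
  then show ?thesis using assms by (auto simp: deformed_def lookup_add lookup_minus)
qed

lemma deformed_shift_zero:
  assumes "Poly_Mapping.lookup j l = 0" "l \<noteq> i"
  shows "deformed y i b (d + Poly_Mapping.single l 1, j) = 0"
  using assms deformed_nonzeroD(2)[of y i b "d + Poly_Mapping.single l 1" j l]
  by (force simp: lookup_add)

text \<open>Multiplying the Newton element \<open>d\<close> by the variable \<open>l\<close> gives
  the element \<open>d + single l 1\<close> plus \<open>y (d l)\<close> times itself; comparing
  coefficients at \<open>j\<close> explains the two node terms. Only the factor at \<open>l\<close>
  changes, and there \<open>dd_weight_shift\<close> applies.\<close>

lemma deformed_shift:
  assumes y: "inj y" and "Poly_Mapping.lookup j l \<noteq> 0" "l \<noteq> i"
  shows "deformed y i b (d + Poly_Mapping.single l 1, j) - deformed y i b (d, j - Poly_Mapping.single l 1)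
     = (y (Poly_Mapping.lookup j l) - y (Poly_Mapping.lookup d l)) * deformed y i b (d, j)"
proof -
  let ?u = "Poly_Mapping.single l (1::nat)"
  let ?w = "\<lambda>d j l. dd_weight y (Poly_Mapping.lookup d l) (Poly_Mapping.lookup b l) (Poly_Mapping.lookup j l)"
  define R where "R = (\<Prod>l\<in>-{i}-{l}. ?w d j l)"
  have split: "(\<Prod>l\<in>-{i}. ?w d' j' l) = ?w d' j' l * (\<Prod>l\<in>-{i}-{l}. ?w d' j' l)" for d' j'
    using assms by (intro prod.remove) auto
  have "(\<Prod>l\<in>-{i}-{l}. ?w (d + ?u) j l) = R" "(\<Prod>l\<in>-{i}-{l}. ?w d (j - ?u) l) = R"
    unfolding R_def by (auto intro!: prod.cong simp: lookup_add lookup_minus lookup_single when_def)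
  then have prods: "(\<Prod>l\<in>-{i}. ?w (d + ?u) j l) = ?w (d + ?u) j l * R"
      "(\<Prod>l\<in>-{i}. ?w d (j - ?u) l) = ?w d (j - ?u) l * R" "(\<Prod>l\<in>-{i}. ?w d j l) = ?w d j l * R"
    by (simp_all only: split R_def)
  obtain n where n: "Poly_Mapping.lookup j l = Suc n"
    using assms(2) not0_implies_Suc by blast
  have "?w (d + ?u) j l - ?w d (j - ?u) l = (y (Poly_Mapping.lookup j l) - y (Poly_Mapping.lookup d l)) * ?w d j l"
    using dd_weight_shift[OF y] by (simp add: lookup_add lookup_minus n)
  then have "?w (d + ?u) j l * R - ?w d (j - ?u) l * R = (y (Poly_Mapping.lookup j l) - y (Poly_Mapping.lookup d l)) * (?w d j l * R)"
    by (metis left_diff_distrib mult.assoc)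
  moreover have "Poly_Mapping.lookup (d + ?u) i = Poly_Mapping.lookup d i"
      "Poly_Mapping.lookup (j - ?u) i = Poly_Mapping.lookup j i"
    using assms(3) by (simp_all add: lookup_add lookup_minus lookup_single when_def)
  ultimately show ?thesis
    unfolding deformed_def prod.case prods by simp
qed

lemma transverse_degree_shift:
  assumes "l \<noteq> i"
  shows "transverse_degree i (d + Poly_Mapping.single l 1, j) = transverse_degree i (d, j) - 1"
    and "Poly_Mapping.lookup j l \<noteq> 0 \<Longrightarrow>
       transverse_degree i (d, j - Poly_Mapping.single l 1) = transverse_degree i (d, j) - 1"
proof -
  have split: "transverse_degree i (d', j') = int (Poly_Mapping.lookup j' l) - int (Poly_Mapping.lookup d' l)
    + (\<Sum>l\<in>-{i}-{l}. int (Poly_Mapping.lookup j' l) - int (Poly_Mapping.lookup d' l))" for d' j'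
    unfolding transverse_degree_def prod.case using assms by (intro sum.remove) auto
  have "(\<Sum>k\<in>-{i}-{l}. int (Poly_Mapping.lookup j k) - int (Poly_Mapping.lookup (d + Poly_Mapping.single l 1) k))
      = (\<Sum>k\<in>-{i}-{l}. int (Poly_Mapping.lookup j k) - int (Poly_Mapping.lookup d k))"
    by (intro sum.cong) (auto simp: lookup_add lookup_single when_def)
  then show "transverse_degree i (d + Poly_Mapping.single l 1, j) = transverse_degree i (d, j) - 1"
    unfolding split by (simp add: lookup_add)
  assume "Poly_Mapping.lookup j l \<noteq> 0"
  moreover have "(\<Sum>k\<in>-{i}-{l}. int (Poly_Mapping.lookup (j - Poly_Mapping.single l 1) k) - int (Poly_Mapping.lookup d k))
      = (\<Sum>k\<in>-{i}-{l}. int (Poly_Mapping.lookup j k) - int (Poly_Mapping.lookup d k))"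
    by (intro sum.cong) (auto simp: lookup_minus lookup_single when_def)
  ultimately show "transverse_degree i (d, j - Poly_Mapping.single l 1) = transverse_degree i (d, j) - 1"
    unfolding split by (simp add: lookup_minus of_nat_diff)
qed

lemma transverse_degree_shift_axis:
  "transverse_degree i (d + Poly_Mapping.single i 1, j) = transverse_degree i (d, j)"
  "transverse_degree i (d, j - Poly_Mapping.single i 1) = transverse_degree i (d, j)"
  unfolding transverse_degree_def
  by (auto intro!: sum.cong simp: lookup_add lookup_minus lookup_single when_def)

text \<open>The relation satisfied by deformed vectors differs from that of tangent vectors by a term of
  higher degree, which vanishes in the top degree.\<close>

lemma leading_form_tangent:
  fixes \<beta> :: "'n::finite mon set" and y :: "nat \<Rightarrow> 'k::field"
  assumes \<beta>: "basis_set \<beta>" and y: "inj y"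
    and H: "\<And>s. H s = (\<Sum>b\<in>\<beta>. g b * deformed y i b s)"
    and D: "\<And>d j. d \<notin> \<beta> \<Longrightarrow> j \<in> \<beta> \<Longrightarrow> H (d, j) \<noteq> 0 \<Longrightarrow> transverse_degree i (d, j) \<le> D"
  shows "tangent \<beta> (\<lambda>s. if transverse_degree i s = D then H s else 0)" (is "tangent _ ?\<tau>")
proof (rule tangentI[OF \<beta>])
  fix d j :: "'n mon" and l :: 'n assume d: "d \<notin> \<beta>" and j: "j \<in> \<beta>"
  let ?u = "Poly_Mapping.single l (1::nat)"
  show "?\<tau> (d + ?u, j) = (if Poly_Mapping.lookup j l = 0 then 0 else ?\<tau> (d, j - ?u))"
  proof (cases "l = i")
    case i: True
    show ?thesis
    proof (cases "Poly_Mapping.lookup j i = 0")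
      case True
      \<comment> \<open>With \<open>j i = 0\<close> a nonzero entry has \<open>d i = b i\<close>,
        and \<open>d l \<le> b l\<close> elsewhere, so \<open>d\<close> would divide
        \<open>b\<close> and lie in \<beta>.\<close>
      have "deformed y i b (d + ?u, j) = 0" if b: "b \<in> \<beta>" for b
      proof (rule ccontr)
        assume nz: "deformed y i b (d + ?u, j) \<noteq> 0"
        have "Poly_Mapping.lookup d l' \<le> Poly_Mapping.lookup b l'" for l'
          using deformed_nonzeroD(1)[OF nz] deformed_nonzeroD(2)[OF nz, of l'] True i
          by (cases "l' = i") (auto simp: lookup_add)
        then have "d \<in> \<beta>" using \<beta> b unfolding basis_set_def mon_dvd_def by blast
        then show False using d by blast
      qed
      then show ?thesis using True i by (simp add: H)
    next
      case False
      then show ?thesis using i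
        by (simp add: H transverse_degree_shift_axis deformed_shift_axis[OF False] del: One_nat_def)
    qed
  next
    case l: False
    show ?thesis
    proof (cases "Poly_Mapping.lookup j l = 0")
      case True
      then show ?thesis using l by (simp add: H deformed_shift_zero del: One_nat_def)
    next
      case False
      have "H (d + ?u, j) - H (d, j - ?u) = 
          (y (Poly_Mapping.lookup j l) - y (Poly_Mapping.lookup d l)) * H (d, j)"
        unfolding H sum_subtractf[symmetric] right_diff_distrib[symmetric] deformed_shift[OF y False l]
        by (simp add: sum_distrib_left mult_ac)
      \<comment> \<open>Both shifted arrows have degree one below that of \<open>(d, j)\<close>; if
        this is \<open>D\<close>, then \<open>(d, j)\<close> exceeds the bound.\<close>
      moreover have "H (d, j) = 0" if "transverse_degree i (d, j) - 1 = D"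
        using D[OF d j] that by force
      ultimately have "H (d + ?u, j) = H (d, j - ?u)" if "transverse_degree i (d, j) - 1 = D"
        using that by (metis eq_iff_diff_eq_0 mult_zero_right)
      then show ?thesis using l False
        by (simp add: transverse_degree_shift del: One_nat_def)
    qed
  qed
qed

section \<open>Nonvanishing of leading forms\<close>

text \<open>Some arrow isolates the coefficient of \<open>b\<close>: its tail is the first monomial
  outside \<beta> on the ray from \<open>b\<close> in direction \<open>i\<close>, and its vector is
  \<open>-(b i + 1)\<close> along \<open>i\<close>.\<close>

lemma deformed_combination_nonzero:
  fixes \<beta> :: "'n::finite mon set" and y :: "nat \<Rightarrow> 'k::field"
  assumes \<beta>: "basis_set \<beta>" and b: "b \<in> \<beta>"
  obtains d j where "d \<notin> \<beta>" "j \<in> \<beta>" "(\<Sum>c\<in>\<beta>. g c * deformed y i c (d, j)) = g b"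
proof -
  let ?u = "\<lambda>t. Poly_Mapping.single i (t::nat)"
  have "inj (\<lambda>t. b + ?u t)" by (auto intro!: injI dest: injD[OF inj_single])
  then have "\<not> range (\<lambda>t. b + ?u t) \<subseteq> \<beta>"
    using basis_set_finite[OF \<beta>] finite_subset finite_imageD by (metis infinite_UNIV_nat)
  then have ex: "\<exists>t. b + ?u t \<notin> \<beta>" by blast
  define t where "t = (LEAST t. b + ?u t \<notin> \<beta>)"
  have t: "b + ?u t \<notin> \<beta>" unfolding t_def using ex by (rule LeastI_ex)
  have "t \<noteq> 0" using t b by (metis single_zero add.right_neutral)
  then obtain t' where t': "t = Suc t'" using not0_implies_Suc by blast
  have "b + ?u t' \<in> \<beta>" using not_less_Least[of t' "\<lambda>t. b + ?u t \<notin> \<beta>"] t' unfolding t_def by auto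
  \<comment> \<open>The component \<open>j i = t'\<close> turns the condition on \<open>d i\<close>
    into \<open>c i = b i\<close>, and in the other variables \<open>c\<close> is squeezed between
    equal components of \<open>d\<close> and \<open>j\<close>.\<close>
  define j where "j = b - ?u (Poly_Mapping.lookup b i) + ?u t'"
  have "mon_dvd j (b + ?u t')"
    unfolding mon_dvd_def j_def by (auto simp: lookup_add lookup_minus lookup_single when_def)
  then have j: "j \<in> \<beta>" using \<open>b + ?u t' \<in> \<beta>\<close> \<beta> unfolding basis_set_def by blast
  have j_lookup: "Poly_Mapping.lookup j l = (if l = i then t' else Poly_Mapping.lookup b l)" for l
    by (auto simp: j_def lookup_add lookup_minus lookup_single when_def)
  have val: "deformed y i c (b + ?u t, j) = (if c = b then 1 else 0)" for c
  proof (cases "c = b")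
    case True
    have "(\<Prod>l\<in>-{i}. dd_weight y (Poly_Mapping.lookup (b + ?u t) l) (Poly_Mapping.lookup b l) (Poly_Mapping.lookup j l)) = 1"
      by (intro prod.neutral) (auto simp: lookup_add j_lookup lookup_single when_def dd_weight_same)
    then show ?thesis using True by (simp add: deformed_def lookup_add j_lookup t')
  next
    case False
    have "deformed y i c (b + ?u t, j) = 0"
    proof (rule ccontr)
      assume nz: "deformed y i c (b + ?u t, j) \<noteq> 0"
      have "Poly_Mapping.lookup c l = Poly_Mapping.lookup b l" for l
        using deformed_nonzeroD(1)[OF nz] deformed_nonzeroD(2)[OF nz, of l]
        by (cases "l = i") (auto simp: lookup_add j_lookup t' lookup_single when_def)
      then have "c = b" by (rule poly_mapping_eqI)
      then show False using False by blast
    qed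
    then show ?thesis using False by simp
  qed
  have "(\<Sum>c\<in>\<beta>. g c * deformed y i c (b + ?u t, j)) = (\<Sum>c\<in>\<beta>. if c = b then g c else 0)"
    by (intro sum.cong) (auto simp: val)
  also have "\<dots> = g b" using b basis_set_finite[OF \<beta>] by simp
  finally have "(\<Sum>c\<in>\<beta>. g c * deformed y i c (b + ?u t, j)) = g b" .
  then show ?thesis using that t j by blast
qed

text \<open>Truncating to the top transverse degree keeps an entry or replaces it by 0, as
  \<open>exists_independent_coordinates\<close> expects. The top degree is attained, so the leading
  form is nonzero, hence nonzero on a minimal generator.\<close>

lemma exists_leading_form:
  fixes \<beta> :: "'n::finite mon set" and y :: "nat \<Rightarrow> 'k::field"
  assumes \<beta>: "basis_set \<beta>" and y: "inj y" and b: "b \<in> \<beta>" "g b \<noteq> 0"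
  shows "\<exists>\<tau> d j. tangent \<beta> \<tau> \<and> minimal_generator \<beta> d \<and> j \<in> \<beta> \<and> \<tau> (d, j) \<noteq> 0 \<and>
    (\<forall>s. \<tau> s \<noteq> 0 \<longrightarrow> \<tau> s = (\<Sum>b\<in>\<beta>. g b * deformed y i b s))"
proof -
  define H where "H = (\<lambda>s. \<Sum>b\<in>\<beta>. g b * deformed y i b s)"
  define A where "A = {s. fst s \<notin> \<beta> \<and> snd s \<in> \<beta> \<and> H s \<noteq> 0}"
  obtain d1 j1 where "d1 \<notin> \<beta>" "j1 \<in> \<beta>" "(\<Sum>c\<in>\<beta>. g c * deformed y i c (d1, j1)) = g b"
    by (rule deformed_combination_nonzero[OF \<beta> b(1), where g = g and y = y and i = i])
  then have "(d1, j1) \<in> A" using b(2) by (simp add: A_def H_def)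
  then have "A \<noteq> {}" by blast
  define B where "B = Max ((\<lambda>j. \<Sum>l\<in>-{i}. int (Poly_Mapping.lookup j l)) ` \<beta>)"
  \<comment> \<open>Only finitely many degrees occur: nonzero entries have
    \<open>d l \<le> j l\<close> off \<open>i\<close>, and \<open>j\<close> ranges over the finite
    set \<beta>.\<close>
  have "transverse_degree i s \<in> {0..B}" if "s \<in> A" for s
  proof -
    obtain d j where s: "s = (d, j)" by fastforce
    have "H (d, j) \<noteq> 0" "j \<in> \<beta>" using that unfolding A_def s by auto
    then obtain c where "c \<in> \<beta>" "g c * deformed y i c (d, j) \<noteq> 0"
      unfolding H_def by (elim sum.not_neutral_contains_not_neutral)
    then have c: "deformed y i c (d, j) \<noteq> 0" by simp
    have le: "Poly_Mapping.lookup d l \<le> Poly_Mapping.lookup j l" if "l \<noteq> i" for l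
      using deformed_nonzeroD(2)[OF c that] by linarith
    have "0 \<le> transverse_degree i s"
      unfolding transverse_degree_def s prod.case by (intro sum_nonneg) (simp add: le)
    moreover have "transverse_degree i s \<le> (\<Sum>l\<in>-{i}. int (Poly_Mapping.lookup j l))"
      unfolding transverse_degree_def s prod.case by (intro sum_mono) simp
    moreover have "\<dots> \<le> B"
      unfolding B_def using \<open>j \<in> \<beta>\<close> basis_set_finite[OF \<beta>] by (intro Max_ge) auto
    ultimately show ?thesis by simp
  qed
  then have fin: "finite (transverse_degree i ` A)"
    by (meson finite_atLeastAtMost_int finite_subset image_subsetI)
  define D where "D = Max (transverse_degree i ` A)"
  define \<tau> where "\<tau> = (\<lambda>s. if transverse_degree i s = D then H s else 0)"
  have "D \<in> transverse_degree i ` A"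
    unfolding D_def using fin \<open>A \<noteq> {}\<close> by (intro Max_in) auto
  then obtain d0 j0 where dj0: "d0 \<notin> \<beta>" "j0 \<in> \<beta>" "\<tau> (d0, j0) \<noteq> 0"
    unfolding A_def \<tau>_def by auto
  have tan: "tangent \<beta> \<tau>"
    unfolding \<tau>_def
  proof (rule leading_form_tangent[OF \<beta> y])
    fix d j assume "d \<notin> \<beta>" "j \<in> \<beta>" "H (d, j) \<noteq> 0"
    then have "(d, j) \<in> A" unfolding A_def by auto
    then show "transverse_degree i (d, j) \<le> D" unfolding D_def using fin by auto
  qed (simp add: H_def)
  obtain d j where "minimal_generator \<beta> d" "j \<in> \<beta>" "\<tau> (d, j) \<noteq> 0"
    using tangent_nonzero_minimal[OF \<beta> tan dj0] by blast
  moreover have "\<tau> s = H s" if "\<tau> s \<noteq> 0" for s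
    using that unfolding \<tau>_def by auto
  ultimately show ?thesis using tan unfolding H_def by blast
qed

lemma deformed_standard:
  assumes "deformed y i b s \<noteq> 0"
  shows "standard_arrow s"
proof -
  obtain d j where s: "s = (d, j)" by fastforce
  have "{l. Poly_Mapping.lookup j l < Poly_Mapping.lookup d l} = {i}"
    using deformed_nonzeroD[OF assms[unfolded s]] by (force simp: not_less)
  then show ?thesis by (simp add: standard_arrow_def s)
qed

text \<open>The vector of \<open>s\<close> has its only negative component in direction
  \<open>i\<close>, of value \<open>-(b i + 1)\<close>. Hence families with different
  \<open>i\<close> or different \<open>b i\<close> have disjoint supports.\<close>

lemma deformed_unique:
  assumes "deformed y i b s \<noteq> 0" "deformed y i' c s \<noteq> 0"
  shows "i' = i \<and> Poly_Mapping.lookup c i = Poly_Mapping.lookup b i"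
proof -
  obtain d j where s: "s = (d, j)" by fastforce
  note D = deformed_nonzeroD[OF assms(1)[unfolded s]] deformed_nonzeroD[OF assms(2)[unfolded s]]
  have "i' = i" using D(1) D(4)[of i] by (cases "i' = i") auto
  then show ?thesis using D(1,3) by auto
qed

theorem theorem4p3:
  fixes \<beta> :: "('n::finite) mon set"
  assumes "basis_set \<beta>"
  shows "\<exists>S. finite S \<and> (\<forall>s\<in>S. minimal_standard_arrow \<beta> s)
             \<and> card S = CARD('n) * card \<beta>
             \<and> cotangent_indep \<beta> S TYPE('k::alg_closed_field)"
proof -
  note \<beta> = assms
  obtain y :: "nat \<Rightarrow> 'k" where y: "inj y"
    using infinite_countable_subset[OF infinite_UNIV_alg_closed_field] by blast
  define F where "F = (\<lambda>(i :: 'n, b). deformed y i b)"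
  let ?K = "UNIV \<times> \<beta> :: ('n \<times> 'n mon) set"
  have "finite ?K" using basis_set_finite[OF \<beta>] by simp
  then have "\<exists>S\<subseteq>{s. minimal_standard_arrow \<beta> s}. finite S \<and> card S = card ?K \<and>
    (\<forall>a. (\<forall>\<tau>\<in>{\<tau> :: 'n arrow \<Rightarrow> 'k. tangent \<beta> \<tau>}. (\<Sum>s\<in>S. a s * \<tau> s) = 0) \<longrightarrow> (\<forall>s\<in>S. a s = 0))"
  proof (rule exists_independent_coordinates[where F = F])
    fix c :: "'n \<times> 'n mon \<Rightarrow> 'k" assume "\<exists>k\<in>?K. c k \<noteq> 0"
    then obtain i b0 where b0: "b0 \<in> \<beta>" "c (i, b0) \<noteq> 0" by auto
    \<comment> \<open>One class of indices, with \<open>i\<close> and \<open>b i\<close> fixed, is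
      enough: by \<open>deformed_unique\<close> the other classes vanish wherever this one does not,
      so there the full combination agrees with it.\<close>
    define g where "g = (\<lambda>b. if Poly_Mapping.lookup b i = Poly_Mapping.lookup b0 i then c (i, b) else 0)"
    have g: "g b0 \<noteq> 0" using b0 by (simp add: g_def)
    obtain \<tau> d j where \<tau>: "tangent \<beta> \<tau>" "minimal_generator \<beta> d" "j \<in> \<beta>" "\<tau> (d, j) \<noteq> 0"
      "\<And>s. \<tau> s \<noteq> 0 \<Longrightarrow> \<tau> s = (\<Sum>b\<in>\<beta>. g b * deformed y i b s)"
      using exists_leading_form[where g = g and b = b0 and i = i, OF \<beta> y b0(1) g] by blast
    have supp: "\<exists>b\<in>\<beta>. g b \<noteq> 0 \<and> deformed y i b s \<noteq> 0" if "\<tau> s \<noteq> 0" for s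
    proof -
      have "(\<Sum>b\<in>\<beta>. g b * deformed y i b s) \<noteq> 0" using \<tau>(5)[OF that] that by simp
      then obtain b where "b \<in> \<beta>" "g b * deformed y i b s \<noteq> 0"
        by (elim sum.not_neutral_contains_not_neutral)
      then show ?thesis by auto
    qed
    have "minimal_standard_arrow \<beta> (d, j)"
      using \<tau>(2,3) supp[OF \<tau>(4)] deformed_standard
      unfolding minimal_standard_arrow_def is_arrow_def minimal_generator_def by auto
    moreover have "\<tau> s = (\<Sum>k\<in>?K. c k * F k s)" if nz: "\<tau> s \<noteq> 0" for s
    proof -
      obtain b where b: "g b \<noteq> 0" "deformed y i b s \<noteq> 0" using supp[OF nz] by blast
      have "(\<Sum>k\<in>?K. c k * F k s) = (\<Sum>k\<in>{i} \<times> \<beta>. c k * F k s)"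
        using \<open>finite ?K\<close> deformed_unique[OF b(2)]
        by (intro sum.mono_neutral_right) (auto simp: F_def)
      also have "\<dots> = (\<Sum>a\<in>\<beta>. c (i, a) * deformed y i a s)"
        unfolding sum.cartesian_product' by (simp add: F_def)
      also have "\<dots> = (\<Sum>a\<in>\<beta>. g a * deformed y i a s)"
        using deformed_unique[OF b(2), of i] b(1)
        by (intro sum.cong) (auto simp: g_def split: if_splits)
      finally show ?thesis using \<tau>(5)[OF nz] by simp
    qed
    ultimately show "\<exists>\<tau>\<in>{\<tau>. tangent \<beta> \<tau>}. \<exists>s\<in>{s. minimal_standard_arrow \<beta> s}. \<tau> s \<noteq> 0 \<and>
        (\<forall>x\<in>{s. minimal_standard_arrow \<beta> s}. \<tau> x \<noteq> 0 \<longrightarrow> \<tau> x = (\<Sum>k\<in>?K. c k * F k x))"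
      using \<tau>(1,4) by (intro bexI[of _ \<tau>] bexI[of _ "(d, j)"] conjI ballI impI) simp_all
  qed
  then obtain S where S: "S \<subseteq> {s. minimal_standard_arrow \<beta> s}" "finite S" "card S = card ?K"
    and indep: "\<forall>a. (\<forall>\<tau>\<in>{\<tau> :: 'n arrow \<Rightarrow> 'k. tangent \<beta> \<tau>}. (\<Sum>s\<in>S. a s * \<tau> s) = 0) \<longrightarrow> (\<forall>s\<in>S. a s = 0)"
    by blast
  have "cotangent_indep \<beta> S TYPE('k)"
    using \<beta>
  proof (rule cotangent_indepI)
    fix a :: "'n arrow \<Rightarrow> 'k"
    assume "\<And>\<tau>. tangent \<beta> \<tau> \<Longrightarrow> (\<Sum>s\<in>S. a s * \<tau> s) = 0"
    then show "\<forall>s\<in>S. a s = 0" using indep[THEN spec, of a] by simp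
  qed
  then show ?thesis using S by (intro exI[of _ S]) (auto simp: card_cartesian_product)
qed

end
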